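(* Let $\Gamma$ be a (directed or undirected) strongly regular graph with parameters $(n,k,t,\lambda,\mu)$ and let $\bar\Gamma$ be its complementary digraph, with parameters $(n,\bar k,\bar t,\bar\lambda,\bar\mu)=(n,\,n-k-1,\,n-2k+t-1,\,n-2k+\mu-2,\,n-2k+\lambda)$. Let $\pi=\{C_1,\dots,C_a\}$ be a homogeneous partition of the common vertex set into $a$ cells of size $b$ which is column equitable for $\Gamma$ with quotient matrix $(\lambda+b-k)I+\mu(J-I)$ and column equitable for $\bar\Gamma$ with quotient matrix $(\bar\lambda+b-\bar k)I+\bar\mu(J-I)$. Then $\mu+\bar\mu=n/2$ and $\pi$ has precisely two cells.
   Context: A directed strongly regular graph (DSRG) with parameters $(n,k,t,\lambda,\mu)$ is a loopless digraph on $n$ vertices whose adjacency matrix $A$ satisfies $AJ=JA=kJ$ and $A^2=tI+\lambda A+\mu(J-I-A)$; an undirected strongly regular graph $(n,k,\lambda,\mu)$ is regarded as a DSRG $(n,k,k,\lambda,\mu)$. The complementary digraph $\bar\Gamma$ has adjacency matrix $J-I-A$; it is a DSRG with the parameters given in the claim. A partition is homogeneous of degree $b$ if all cells have exactly $b$ vertices. A partition $\{C_1,\dots,C_a\}$ is column equitable with quotient matrix $Q=(q_{i,l})$ if for all $i,l$ and every vertex $v\in C_l$, the number of arcs from vertices of $C_i$ to $v$ equals $q_{i,l}$. $I$ and $J$ denote the $a\times a$ identity and all-ones matrices. *)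

theory Defs
  imports "HOL-Analysis.Analysis" "HOL-Library.Disjoint_Sets"
begin

text \<open>
  A digraph on the vertex set \<open>UNIV :: 'v set\<close> is given by its arc set
  \<open>E :: ('v \<times> 'v) set\<close>, where \<open>(u, v) \<in> E\<close> is an arc from \<open>u\<close> to \<open>v\<close>.
\<close>

definition adj_matrix :: "('v::finite \<times> 'v) set \<Rightarrow> real^'v^'v" where
  "adj_matrix E = (\<chi> u v. if (u, v) \<in> E then 1 else 0)"

definition ones_matrix :: "real^'i^'i" where
  "ones_matrix = (\<chi> i j. 1)"

definition complement_digraph :: "('v \<times> 'v) set \<Rightarrow> ('v \<times> 'v) set" where
  "complement_digraph E = {(u, v). u \<noteq> v \<and> (u, v) \<notin> E}"

text \<open>
  The parameters are natural numbers.  Undirected strongly regular graphs \<open>(n, k, \<lambda>, \<mu>)\<close> are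
  the case \<open>t = k\<close>, with every edge represented by two opposite arcs.  Complete and empty digraphs
  are not excluded.
\<close>

definition dsrg :: "('v::finite \<times> 'v) set \<Rightarrow> nat \<Rightarrow> nat \<Rightarrow> nat \<Rightarrow> nat \<Rightarrow> nat \<Rightarrow> bool" where
  "dsrg E n k t l m \<longleftrightarrow>
     CARD('v) = n \<and> irrefl E \<and>
     adj_matrix E ** ones_matrix = real k *\<^sub>R ones_matrix \<and>
     ones_matrix ** adj_matrix E = real k *\<^sub>R ones_matrix \<and>
     adj_matrix E ** adj_matrix E =
       real t *\<^sub>R mat 1 + real l *\<^sub>R adj_matrix E
       + real m *\<^sub>R (ones_matrix - mat 1 - adj_matrix E)"

text \<open>Cells are indexed injectively by a finite type, so the number of cells is \<open>CARD('c)\<close>.\<close>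

definition homogeneous_partition :: "('c::finite \<Rightarrow> 'v set) \<Rightarrow> nat \<Rightarrow> bool" where
  "homogeneous_partition C b \<longleftrightarrow>
     partition_on UNIV (range C) \<and> inj C \<and> (\<forall>i. card (C i) = b)"

definition column_equitable ::
    "('v::finite \<times> 'v) set \<Rightarrow> ('c::finite \<Rightarrow> 'v set) \<Rightarrow> real^'c^'c \<Rightarrow> bool" where
  "column_equitable E C Q \<longleftrightarrow>
     (\<forall>i l. \<forall>v\<in>C l. real (card {u \<in> C i. (u, v) \<in> E}) = Q $ i $ l)"

lemma adj_matrix_complement:
  assumes "irrefl E"
  shows "adj_matrix (complement_digraph E) = ones_matrix - mat 1 - adj_matrix E"
  using assms
  by (auto simp: vec_eq_iff adj_matrix_def ones_matrix_def complement_digraph_def mat_def irrefl_def)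

lemma dsrg_complement:
  fixes E :: "('v::finite \<times> 'v) set"
  assumes "dsrg E n k t l m"
    and "int k' = int n - int k - 1"
    and "int t' = int n - 2 * int k + int t - 1"
    and "int l' = int n - 2 * int k + int m - 2"
    and "int m' = int n - 2 * int k + int l"
  shows "dsrg (complement_digraph E) n k' t' l' m'"
proof -
  define A :: "real^'v^'v" where "A = adj_matrix E"
  define J :: "real^'v^'v" where "J = ones_matrix"
  have n: "CARD('v) = n" and irr: "irrefl E"
    and AJ: "A ** J = real k *\<^sub>R J" and JA: "J ** A = real k *\<^sub>R J"
    and AA: "A ** A = real t *\<^sub>R mat 1 + real l *\<^sub>R A + real m *\<^sub>R (J - mat 1 - A)"
    using assms(1) by (auto simp: dsrg_def A_def J_def)
  have JJ: "J ** J = real n *\<^sub>R J"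
    by (simp add: J_def vec_eq_iff matrix_matrix_mult_def ones_matrix_def n)
  have sub: "(X - Y) ** Z = X ** Z - Y ** Z" "Z ** (X - Y) = Z ** X - Z ** Y"
    for X Y Z :: "real^'v^'v"
    by (simp_all add: vec_eq_iff matrix_matrix_mult_def left_diff_distrib right_diff_distrib
        sum_subtractf)
  have r: "real k' = real n - real k - 1"
    "real t' = real n - 2 * real k + real t - 1"
    "real l' = real n - 2 * real k + real m - 2"
    "real m' = real n - 2 * real k + real l"
    using assms(2-5) by linarith+
  have B: "adj_matrix (complement_digraph E) = J - mat 1 - A"
    using adj_matrix_complement[OF irr] by (simp add: A_def J_def)
  have "irrefl (complement_digraph E)"
    by (auto simp: irrefl_def complement_digraph_def)
  then show ?thesis
    unfolding dsrg_def B J_def[symmetric]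
    by (simp add: n sub AJ JA JJ AA matrix_mul_lid matrix_mul_rid r)
       (simp add: vec_eq_iff algebra_simps)
qed

end

theory Submission
  imports Defs
begin

text \<open>
  The arcs of a digraph and of its complement entering a vertex \<open>v\<close> from a cell \<open>C\<^sub>i\<close> number
  \<open>b - 1\<close> or \<open>b\<close> in total, according to whether \<open>v\<close> lies in \<open>C\<^sub>i\<close>. The diagonal entries of
  the two quotient matrices thus give \<open>\<lambda> + \<mu> + b = 2k\<close>, that is, the sum of \<open>\<mu>\<close> and its
  complementary parameter is \<open>n - b\<close>; the off-diagonal entries say that this sum is \<open>b\<close>.
  Hence \<open>n = 2b\<close>, unless there is only one cell. In that case \<open>\<mu> = 0\<close> and \<open>\<lambda> = 2k - n\<close>, which makes
  the parameter \<open>\<lambda>\<close> of the complement equal to \<open>-\<lambda> - 2 < 0\<close>.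
\<close>

text \<open>Each \<open>u\<close> other than \<open>v\<close> has an arc to \<open>v\<close> in
  exactly one of the two digraphs; \<open>v\<close> has none, both being loopless.\<close>

lemma card_in_neighbours_complement:
  assumes "finite S" and "irrefl E"
  shows "card {u \<in> S. (u, v) \<in> E} + card {u \<in> S. (u, v) \<in> complement_digraph E} = card (S - {v})"
proof -
  have "S - {v} = {u \<in> S. (u, v) \<in> E} \<union> {u \<in> S. (u, v) \<in> complement_digraph E}"
    using assms(2) by (auto simp: complement_digraph_def irrefl_def)
  then show ?thesis
    using assms(1) by (subst card_Un_disjoint[symmetric]) (auto simp: complement_digraph_def)
qed

lemma column_equitable_complement_sum:
  fixes E :: "('v::finite \<times> 'v) set"
  assumes "irrefl E" and "column_equitable E C Q" and "column_equitable (complement_digraph E) C Q'"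
    and "v \<in> C j"
  shows "Q $ i $ j + Q' $ i $ j = real (card (C i - {v}))"
proof -
  have "Q $ i $ j = real (card {u \<in> C i. (u, v) \<in> E})"
    "Q' $ i $ j = real (card {u \<in> C i. (u, v) \<in> complement_digraph E})"
    using assms(2-4) by (simp_all add: column_equitable_def)
  then show ?thesis
    using card_in_neighbours_complement[of "C i" E v] assms(1) by (simp flip: of_nat_add)
qed

lemma homogeneous_partition_card:
  fixes C :: "'c::finite \<Rightarrow> 'v::finite set"
  assumes "homogeneous_partition C b"
  shows "CARD('v) = CARD('c) * b"
proof -
  have P: "partition_on UNIV (range C)" and "inj C" and b: "\<And>i. card (C i) = b"
    using assms by (auto simp: homogeneous_partition_def)
  have "CARD('v) = card (\<Union> (range C))"
    using partition_onD1[OF P] by simp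
  also have "\<dots> = sum card (range C)"
    using partition_onD2[OF P] by (intro card_Union_disjoint) (auto simp: disjoint_def pairwise_def disjnt_def)
  also have "\<dots> = CARD('c) * b"
    using \<open>inj C\<close> by (simp add: sum.reindex b)
  finally show ?thesis .
qed

theorem theorem3:
  fixes E :: "('v::finite \<times> 'v) set"
    and C :: "'c::finite \<Rightarrow> 'v set"
    and n k t l m k' t' l' m' b :: nat
  assumes "dsrg E n k t l m"
    and "dsrg (complement_digraph E) n k' t' l' m'"
    and "int k' = int n - int k - 1"
    and "int t' = int n - 2 * int k + int t - 1"
    and "int l' = int n - 2 * int k + int m - 2"
    and "int m' = int n - 2 * int k + int l"
    and "homogeneous_partition C b"
    and "column_equitable E C
           ((real l + real b - real k) *\<^sub>R mat 1 + real m *\<^sub>R (ones_matrix - mat 1))"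
    and "column_equitable (complement_digraph E) C
           ((real l' + real b - real k') *\<^sub>R mat 1 + real m' *\<^sub>R (ones_matrix - mat 1))"
  shows "real m + real m' = real n / 2 \<and> card (range C) = 2"
proof -
  have irr: "irrefl E" and n: "CARD('v) = n"
    using assms(1) by (auto simp: dsrg_def)
  have "inj C" and b: "\<And>i. card (C i) = b" and P: "partition_on UNIV (range C)"
    using assms(7) by (auto simp: homogeneous_partition_def)
  have ne: "C i \<noteq> {}" for i
    using partition_onD3[OF P] by (metis rangeI)
  have disj: "C i \<inter> C j = {}" if "i \<noteq> j" for i j
    using partition_onD2[OF P] that \<open>inj C\<close> by (simp add: disjoint_def inj_eq)
  have nb: "n = CARD('c) * b"
    using homogeneous_partition_card[OF assms(7)] n by simp
  note total = column_equitable_complement_sum[OF irr assms(8,9)]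
  obtain j :: 'c and v where v: "v \<in> C j"
    using ne by blast
  \<comment> \<open>Needed for \<open>b - 1\<close> over the naturals and to cancel \<open>b\<close>
    in \<open>CARD('c) * b = 2 * b\<close>.\<close>
  have "b > 0"
    using v b[of j] by (auto simp: card_gt_0_iff)
  have "(real l + real b - real k) + (real l' + real b - real k') = real b - 1"
    using total[OF v, of j] v b[of j] \<open>b > 0\<close>
    by (simp add: mat_def ones_matrix_def of_nat_diff)
  \<comment> \<open>Here \<open>k + k' = n - 1\<close> and
    \<open>l + l' = m + m' - 2\<close>.\<close>
  then have sum: "m + m' + b = n"
    using assms(3,5,6) by linarith
  have "CARD('c) \<noteq> 1"
  proof
    assume "CARD('c) = 1"
    then have "m = 0" "m' = 0"
      using sum nb by auto
    \<comment> \<open>Now \<open>l + l' = -2\<close>, impossible for naturals.\<close>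
    then show False
      using assms(5,6) by linarith
  qed
  then obtain i where "i \<noteq> j"
    by (metis UNIV_eq_I card_1_singleton_iff insertI1 One_nat_def)
  then have "C i - {v} = C i"
    using v disj[of i j] by blast
  then have "real m + real m' = real b"
    using total[OF v, of i] \<open>i \<noteq> j\<close> b[of i] by (simp add: mat_def ones_matrix_def)
  then have "m + m' = b" and "n = 2 * b"
    using sum by linarith+
  then show ?thesis
    using nb \<open>b > 0\<close> \<open>inj C\<close> by (simp add: card_image flip: of_nat_add)
qed

end
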